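(* Let $R$ be an elementary divisor domain, let $g(t)\in R[t]$ be monic of degree $n$, and let $f(t)\in R[t]$. Suppose that $g(t)=G(t)z(t)$ and $f(t)=F(t)z(t)$, where $z(t)\in R[t]$ is a monic common divisor of $f(t)$ and $g(t)$ and $F(t),G(t)\in R[t]$. Let $m=\deg z(t)$. Then $$f(C_g)\sim F(C_G)\oplus 0_{m\times m}.$$ In particular, with $r=n-m$, the matrix $F(C_G)$ has invariant factors $s_1,\dots,s_r$ if and only if $f(C_g)$ has invariant factors $s_1,\dots,s_r,0,\dots,0$, where $0$ is repeated $m$ times.
   Context: An elementary divisor domain (EDD) is an integral domain $R$ such that for any $a,b,c\in R$ there exist $x,y,z,w\in R$ with $(a,b,c)=zxa+zyb+wyc$, where $(a,b,c)$ denotes the greatest common divisor; equivalently, an integral domain over which every matrix is equivalent to a diagonal matrix $S$ with $S_{i,i}\mid S_{i+1,i+1}$ (its Smith form). The diagonal entries of $S$ are the invariant factors; they are determined up to multiplication by units of $R$. For a monic polynomial $g(t)=t^n+\sum_{k=0}^{n-1}g_kt^k\in R[t]$, the companion matrix $C_g\in R^{n\times n}$ has first row $(-g_{n-1},\dots,-g_1,-g_0)$, entries $1$ in positions $(i+1,i)$ for $1\le i\le n-1$, and $0$ elsewhere. For $f(t)=\sum_k f_kt^k\in R[t]$, $f(C_g)=\sum_k f_kC_g^k$. A $0\times 0$ block (arising when $G=1$ or $z=1$) is simply omitted. A square matrix over $R$ is unimodular if its determinant is a unit of $R$. Two matrices $M,N$ of the same size over $R$ are equivalent, written $M\sim N$,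 if $N=UMV$ with $U,V$ unimodular. $\oplus$ denotes block-diagonal direct sum. *)

theory Defs
  imports
    "HOL-Computational_Algebra.Polynomial"
    "Jordan_Normal_Form.Determinant"
begin

text \<open>
  The conjuncts before the equation say that \<open>d\<close> is a greatest common divisor of \<open>a\<close>, \<open>b\<close>, \<open>c\<close>.
  Its existence is part of the axiom, so no \<open>gcd\<close> operation on the type is presupposed.
\<close>
class elementary_divisor_domain = idom +
  assumes elementary_divisor:
    "\<exists>d x y z w.
       d dvd a \<and> d dvd b \<and> d dvd c \<and> (\<forall>e. e dvd a \<longrightarrow> e dvd b \<longrightarrow> e dvd c \<longrightarrow> e dvd d) \<and>
       d = z * x * a + z * y * b + w * y * c"

text \<open>
  Matrix indices start at 0, so that position \<open>(0, j)\<close> carries the coefficient of index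
  \<open>n - 1 - j\<close>. Only meaningful for monic \<open>g\<close>; for \<open>g = 1\<close> it is the \<open>0 \<times> 0\<close> matrix.
\<close>
definition companion_mat :: "'a::comm_ring_1 poly \<Rightarrow> 'a mat" where
  "companion_mat g = mat (degree g) (degree g)
     (\<lambda>(i, j). if i = 0 then - coeff g (degree g - 1 - j) else if i = Suc j then 1 else 0)"

text \<open>
  The sum of the \<open>f\<^sub>k A\<^sup>k\<close> is written entrywise because the type of matrices of all sizes
  is not an additive monoid.
\<close>
definition poly_mat :: "'a::comm_ring_1 poly \<Rightarrow> 'a mat \<Rightarrow> 'a mat" where
  "poly_mat f A = mat (dim_row A) (dim_row A)
     (\<lambda>ij. \<Sum>k\<le>degree f. (coeff f k \<cdot>\<^sub>m (A ^\<^sub>m k)) $$ ij)"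

definition unimodular_mat :: "'a::comm_ring_1 mat \<Rightarrow> bool" where
  "unimodular_mat U \<longleftrightarrow> square_mat U \<and> det U dvd 1"

definition equivalent_mat :: "'a::comm_ring_1 mat \<Rightarrow> 'a mat \<Rightarrow> bool" where
  "equivalent_mat M N \<longleftrightarrow>
     dim_row M = dim_row N \<and> dim_col M = dim_col N \<and>
     (\<exists>U \<in> carrier_mat (dim_row M) (dim_row M). \<exists>V \<in> carrier_mat (dim_col M) (dim_col M).
        unimodular_mat U \<and> unimodular_mat V \<and> N = U * M * V)"

definition smith_form_mat :: "'a::comm_ring_1 mat \<Rightarrow> bool" where
  "smith_form_mat S \<longleftrightarrow> diagonal_mat S \<and>
     (\<forall>i. Suc i < min (dim_row S) (dim_col S) \<longrightarrow> S $$ (i, i) dvd S $$ (Suc i, Suc i))"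

text \<open>
  A predicate rather than a function, since invariant factors are determined only up to units.
\<close>
definition has_invariant_factors :: "'a::comm_ring_1 mat \<Rightarrow> 'a list \<Rightarrow> bool" where
  "has_invariant_factors M ss \<longleftrightarrow>
     (\<exists>S. smith_form_mat S \<and> equivalent_mat M S \<and>
          ss = map (\<lambda>i. S $$ (i, i)) [0..<min (dim_row S) (dim_col S)])"

end

theory Submission
  imports Defs
begin

text \<open>
  \<^bold>\<open>The block form.\<close> Row \<open>i\<close> of \<open>f(C\<^sub>g)\<close> lists the coefficients of \<open>t\<^bsup>n-1-i\<^esup> f mod g\<close> in
  descending order, so \<open>f(C\<^sub>g)\<close> is the matrix of multiplication by \<open>f\<close> on the free module
  \<open>R[t]/(g)\<close>. Let \<open>g = G z\<close>, \<open>f = F z\<close>, \<open>r = deg G\<close>, \<open>m = deg z\<close>. Take the basis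
  \<open>t\<^bsup>r-1\<^esup>, \<dots>, 1, G t\<^bsup>m-1\<^esup>, \<dots>, G\<close> in the source and \<open>z t\<^bsup>r-1\<^esup>, \<dots>, z, t\<^bsup>m-1\<^esup>, \<dots>, 1\<close> in the
  target. Multiplication by \<open>f\<close> kills every \<open>G t\<^sup>k\<close> modulo \<open>g\<close>, and it sends \<open>t\<^sup>k\<close> to
  \<open>z (F t\<^sup>k mod G)\<close>; so its matrix becomes \<open>F(C\<^sub>G) \<oplus> 0\<close>. Up to an order of the rows both
  changes of basis are unitriangular, because \<open>G\<close> and \<open>z\<close> are monic. This is
  \<open>poly_mat_companion_factor\<close>, and it holds over every integral domain.

  \<^bold>\<open>The invariant factors.\<close> A Smith form of \<open>F(C\<^sub>G)\<close> padded with zeros is a Smith form of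
  \<open>f(C\<^sub>g)\<close>. Conversely, a Smith form of \<open>f(C\<^sub>g)\<close> whose last \<open>m\<close> diagonal entries vanish has the
  form \<open>T \<oplus> 0\<close>, and what is needed is that \<open>A \<oplus> 0 \<sim> T \<oplus> 0\<close> implies \<open>A \<sim> T\<close>
  (\<open>zero_pad_cancel\<close>). Over an elementary divisor domain this cancellation holds because Bezout
  identities split off the kernel of a square matrix until \<open>A \<sim> A\<^sub>1 \<oplus> 0\<close> with \<open>det A\<^sub>1 \<noteq> 0\<close>
  (\<open>obtain_nonsingular_core\<close>). If two such padded nonsingular matrices satisfy \<open>U (A\<^sub>1 \<oplus> 0) = (B\<^sub>1 \<oplus> 0) W\<close>, then the nonsingularity forces
  \<open>U\<close> and \<open>W\<close> to be block triangular. This makes the two sizes equal (\<open>core_size_le\<close>),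
  and the leading blocks of \<open>U\<close> and \<open>W\<close> witness \<open>A\<^sub>1 \<sim> B\<^sub>1\<close> (\<open>core_equivalent\<close>).
\<close>

section \<open>Equivalence of matrices\<close>

lemma index_mult_mat_sum:
  assumes "A \<in> carrier_mat nr n" "B \<in> carrier_mat n nc" "i < nr" "j < nc"
  shows "(A * B) $$ (i, j) = (\<Sum>k<n. A $$ (i, k) * B $$ (k, j))"
  using assms by (simp add: scalar_prod_def atLeast0LessThan)

lemma unimodular_matI:
  assumes "A \<in> carrier_mat n n" "B \<in> carrier_mat n n" "A * B = 1\<^sub>m n"
  shows "unimodular_mat A"
proof -
  have "det A * det B = 1"
    using det_mult[OF assms(1,2)] assms(3) by simp
  then have "det A dvd 1" by (metis dvd_triv_left)
  then show ?thesis using assms(1) unfolding unimodular_mat_def by auto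
qed

lemma unimodular_mat_obtain_inverse:
  assumes A: "A \<in> carrier_mat n n" and u: "unimodular_mat A"
  obtains B where "B \<in> carrier_mat n n" "unimodular_mat B" "A * B = 1\<^sub>m n" "B * A = 1\<^sub>m n"
proof -
  obtain u where u: "det A * u = 1"
    using u unfolding unimodular_mat_def by (metis dvdE)
  define B where "B = u \<cdot>\<^sub>m adj_mat A"
  note adj = adj_mat[OF A]
  have B: "B \<in> carrier_mat n n" using adj(1) by (simp add: B_def)
  have sm: "u \<cdot>\<^sub>m (det A \<cdot>\<^sub>m 1\<^sub>m n) = 1\<^sub>m n"
    using u by (intro eq_matI) (auto simp: mult.commute)
  have AB: "A * B = 1\<^sub>m n"
    unfolding B_def using mult_smult_distrib[OF A adj(1)] adj(2) sm by simp
  have BA: "B * A = 1\<^sub>m n"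
    unfolding B_def using smult_carrier_mat adj A sm by (simp add: mult_smult_assoc_mat[OF adj(1) A])
  show ?thesis using that[OF B unimodular_matI[OF B A BA] AB BA] .
qed

lemma unimodular_mat_mult:
  assumes "A \<in> carrier_mat n n" "B \<in> carrier_mat n n" "unimodular_mat A" "unimodular_mat B"
  shows "unimodular_mat (A * B)"
  using assms det_mult[OF assms(1,2)] mult_dvd_mono[of "det A" 1 "det B" 1]
  by (auto simp: unimodular_mat_def)

lemma unimodular_mat_one: "unimodular_mat (1\<^sub>m n)"
  by (simp add: unimodular_mat_def)

lemma unimodular_mat_transpose:
  assumes "A \<in> carrier_mat n n" "unimodular_mat A"
  shows "unimodular_mat (transpose_mat A)"
  using assms det_transpose[OF assms(1)] by (auto simp: unimodular_mat_def)

text \<open>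
  Moving \<open>V\<close> to the other side as its inverse \<open>W\<close> gives a form that treats \<open>M\<close> and \<open>N\<close>
  alike and in which both sides can be compared entry by entry.
\<close>
lemma equivalent_mat_iff:
  assumes M: "M \<in> carrier_mat nr nc" and N: "N \<in> carrier_mat nr nc"
  shows "equivalent_mat M N \<longleftrightarrow>
    (\<exists>U\<in>carrier_mat nr nr. \<exists>W\<in>carrier_mat nc nc.
       unimodular_mat U \<and> unimodular_mat W \<and> U * M = N * W)"
    (is "_ \<longleftrightarrow> ?rhs")
proof
  assume "equivalent_mat M N"
  then have "\<exists>U\<in>carrier_mat nr nr. \<exists>V\<in>carrier_mat nc nc.
      unimodular_mat U \<and> unimodular_mat V \<and> N = U * M * V"
    unfolding equivalent_mat_def carrier_matD[OF M] by (elim conjE)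
  then obtain U V where U: "U \<in> carrier_mat nr nr" "unimodular_mat U"
    and V: "V \<in> carrier_mat nc nc" "unimodular_mat V" and eq: "N = U * M * V"
    by (elim bexE conjE)
  obtain W where W: "W \<in> carrier_mat nc nc" "unimodular_mat W" "V * W = 1\<^sub>m nc"
    using unimodular_mat_obtain_inverse[OF V] by blast
  have "N * W = U * M * (V * W)"
    unfolding eq by (rule assoc_mult_mat[OF mult_carrier_mat[OF U(1) M] V(1) W(1)])
  then have "U * M = N * W" using W U M by simp
  then show ?rhs using U W by (intro bexI[of _ U] bexI[of _ W] conjI)
next
  assume ?rhs
  then obtain U W where U: "U \<in> carrier_mat nr nr" "unimodular_mat U"
    and W: "W \<in> carrier_mat nc nc" "unimodular_mat W" and eq: "U * M = N * W"
    by (elim bexE conjE)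
  obtain V where V: "V \<in> carrier_mat nc nc" "unimodular_mat V" "W * V = 1\<^sub>m nc"
    using unimodular_mat_obtain_inverse[OF W] by blast
  have "U * M * V = N * (W * V)"
    unfolding eq by (rule assoc_mult_mat[OF N W(1) V(1)])
  then have "N = U * M * V" using N V by simp
  then show "equivalent_mat M N"
    unfolding equivalent_mat_def carrier_matD[OF M] carrier_matD[OF N]
    using U V by (intro conjI bexI[of _ U] bexI[of _ V]) simp_all
qed

lemma equivalent_mat_carrier:
  "equivalent_mat M N \<Longrightarrow> M \<in> carrier_mat nr nc \<longleftrightarrow> N \<in> carrier_mat nr nc"
  unfolding equivalent_mat_def by auto

lemma equivalent_mat_refl: "equivalent_mat M M"
  by (subst equivalent_mat_iff[of _ "dim_row M" "dim_col M"])
    (auto intro!: bexI[of _ "1\<^sub>m _"] simp: unimodular_mat_one)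

lemma equivalent_mat_trans:
  assumes "equivalent_mat L M" "equivalent_mat M N"
  shows "equivalent_mat L N"
proof -
  define nr nc where "nr = dim_row L" and "nc = dim_col L"
  have L: "L \<in> carrier_mat nr nc" and M: "M \<in> carrier_mat nr nc" and N: "N \<in> carrier_mat nr nc"
    using assms unfolding nr_def nc_def equivalent_mat_def by auto
  obtain U W where U: "U \<in> carrier_mat nr nr" "unimodular_mat U"
    and W: "W \<in> carrier_mat nc nc" "unimodular_mat W" and eq: "U * L = M * W"
    using assms(1) unfolding equivalent_mat_iff[OF L M] by (elim bexE conjE)
  obtain U' W' where U': "U' \<in> carrier_mat nr nr" "unimodular_mat U'"
    and W': "W' \<in> carrier_mat nc nc" "unimodular_mat W'" and eq': "U' * M = N * W'"
    using assms(2) unfolding equivalent_mat_iff[OF M N] by (elim bexE conjE)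
  have "U' * U * L = U' * (M * W)" using U U' L eq by simp
  also have "\<dots> = U' * M * W" using U' M W by simp
  also have "\<dots> = N * (W' * W)" unfolding eq' using N W W' by simp
  finally have "U' * U * L = N * (W' * W)" .
  then show ?thesis
    unfolding equivalent_mat_iff[OF L N]
    using U U' W W' unimodular_mat_mult[OF U'(1) U(1)] unimodular_mat_mult[OF W'(1) W(1)]
    by (intro bexI[of _ "U' * U"] bexI[of _ "W' * W"]) auto
qed

lemma equivalent_mat_sym:
  assumes "equivalent_mat M N"
  shows "equivalent_mat N M"
proof -
  define nr nc where "nr = dim_row M" and "nc = dim_col M"
  have M: "M \<in> carrier_mat nr nc" and N: "N \<in> carrier_mat nr nc"
    using assms unfolding nr_def nc_def equivalent_mat_def by auto
  obtain U W where U: "U \<in> carrier_mat nr nr" "unimodular_mat U"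
    and W: "W \<in> carrier_mat nc nc" "unimodular_mat W" and eq: "U * M = N * W"
    using assms(1) unfolding equivalent_mat_iff[OF M N] by (elim bexE conjE)
  obtain U' where U': "U' \<in> carrier_mat nr nr" "unimodular_mat U'" "U' * U = 1\<^sub>m nr"
    using unimodular_mat_obtain_inverse[OF U] by blast
  have "M = U' * U * M" using U' M by simp
  also have "\<dots> = U' * (U * M)" by (rule assoc_mult_mat[OF U'(1) U(1) M])
  also have "\<dots> = U' * N * W" unfolding eq by (rule assoc_mult_mat[OF U'(1) N W(1), symmetric])
  finally have "M = U' * N * W" .
  then show ?thesis
    unfolding equivalent_mat_def carrier_matD[OF M] carrier_matD[OF N]
    using U' W by (intro conjI bexI[of _ U'] bexI[of _ W]) simp_all
qed

section \<open>Padding with zeros\<close>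

text \<open>
  The direct sum \<open>A \<oplus> 0\<close>. The entrywise description makes iterated padding and the
  passage to a leading submatrix immediate; the block form serves for products.
\<close>
definition zero_pad :: "'a::zero mat \<Rightarrow> nat \<Rightarrow> 'a mat" where
  "zero_pad A k = mat (dim_row A + k) (dim_col A + k)
     (\<lambda>(i, j). if i < dim_row A \<and> j < dim_col A then A $$ (i, j) else 0)"

lemma zero_pad_carrier[simp]:
  "A \<in> carrier_mat nr nc \<Longrightarrow> zero_pad A k \<in> carrier_mat (nr + k) (nc + k)"
  by (auto simp: zero_pad_def)

lemma diag_block_mat_zero: "diag_block_mat [A, 0\<^sub>m k k] = zero_pad A k"
  by (intro eq_matI) (auto simp: zero_pad_def Let_def)

lemma zero_pad_four_block:
  "A \<in> carrier_mat nr nc \<Longrightarrow> zero_pad A k = four_block_mat A (0\<^sub>m nr k) (0\<^sub>m k nc) (0\<^sub>m k k)"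
  by (intro eq_matI) (auto simp: zero_pad_def)

lemma zero_pad_zero_pad: "zero_pad (zero_pad A k) l = zero_pad A (k + l)"
  by (intro eq_matI) (auto simp: zero_pad_def)

lemma zero_pad_0[simp]: "zero_pad A 0 = A"
  by (intro eq_matI) (auto simp: zero_pad_def)

lemma unimodular_mat_extend:
  assumes "U \<in> carrier_mat n n" "unimodular_mat U"
  shows "unimodular_mat (four_block_mat U (0\<^sub>m n k) (0\<^sub>m k n) (1\<^sub>m k))"
proof -
  obtain V where V: "V \<in> carrier_mat n n" "U * V = 1\<^sub>m n"
    using unimodular_mat_obtain_inverse[OF assms] by blast
  show ?thesis
  proof (rule unimodular_matI)
    show "four_block_mat U (0\<^sub>m n k) (0\<^sub>m k n) (1\<^sub>m k)
      * four_block_mat V (0\<^sub>m n k) (0\<^sub>m k n) (1\<^sub>m k) = 1\<^sub>m (n + k)"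
      using assms V by (subst mult_four_block_mat[of _ n n _ k _ k _ _ n _ k]) auto
  qed (use assms V in auto)
qed

lemma equivalent_mat_zero_pad:
  assumes "equivalent_mat M N"
  shows "equivalent_mat (zero_pad M k) (zero_pad N k)"
proof -
  define nr nc where "nr = dim_row M" and "nc = dim_col M"
  have M: "M \<in> carrier_mat nr nc" and N: "N \<in> carrier_mat nr nc"
    using assms unfolding nr_def nc_def equivalent_mat_def by auto
  obtain U W where U: "U \<in> carrier_mat nr nr" "unimodular_mat U"
    and W: "W \<in> carrier_mat nc nc" "unimodular_mat W" and eq: "U * M = N * W"
    using assms(1) unfolding equivalent_mat_iff[OF M N] by (elim bexE conjE)
  let ?U = "four_block_mat U (0\<^sub>m nr k) (0\<^sub>m k nr) (1\<^sub>m k)"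
  let ?W = "four_block_mat W (0\<^sub>m nc k) (0\<^sub>m k nc) (1\<^sub>m k)"
  have "?U * zero_pad M k = four_block_mat (U * M) (0\<^sub>m nr k) (0\<^sub>m k nc) (0\<^sub>m k k)"
    unfolding zero_pad_four_block[OF M] using U M
    by (subst mult_four_block_mat[of _ nr nr _ k _ k _ _ nc _ k]) auto
  moreover have "zero_pad N k * ?W = four_block_mat (N * W) (0\<^sub>m nr k) (0\<^sub>m k nc) (0\<^sub>m k k)"
    unfolding zero_pad_four_block[OF N] using W N
    by (subst mult_four_block_mat[of _ nr nc _ k _ k _ _ nc _ k]) auto
  ultimately have "?U * zero_pad M k = zero_pad N k * ?W" using eq by simp
  moreover have "?U \<in> carrier_mat (nr + k) (nr + k)" "?W \<in> carrier_mat (nc + k) (nc + k)"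
    using U W by auto
  ultimately show ?thesis
    unfolding equivalent_mat_iff[OF zero_pad_carrier[OF M] zero_pad_carrier[OF N]]
    using unimodular_mat_extend[OF U] unimodular_mat_extend[OF W] by blast
qed

section \<open>Splitting off the kernel of a singular matrix\<close>

text \<open>
  The defining property at \<open>c = 0\<close> is a Bezout identity for \<open>d = gcd a b\<close>. With \<open>a = d a'\<close> and
  \<open>b = d b'\<close>, the rows \<open>(b', -a')\<close> and the Bezout coefficients form a matrix of determinant \<open>1\<close>.
\<close>
lemma bezout_unimodular:
  fixes a b :: "'a::elementary_divisor_domain"
  obtains T where "T \<in> carrier_mat 2 2" "unimodular_mat T" "T $$ (0, 0) * a + T $$ (0, 1) * b = 0"
proof (cases "a = 0 \<and> b = 0")
  case True
  then show ?thesis using that[of "1\<^sub>m 2"] unimodular_mat_one by auto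
next
  case False
  obtain d x y z w where d: "d dvd a" "d dvd b" "d = z * x * a + z * y * b + w * y * 0"
    using elementary_divisor[of a b 0] by blast
  obtain a' b' where ab: "a = d * a'" "b = d * b'" using d(1,2) unfolding dvd_def by blast
  have "d \<noteq> 0" using False ab by auto
  have "d * 1 = d * (z * x * a' + z * y * b')"
    using d(3) by (simp add: ab algebra_simps)
  then have one: "z * x * a' + z * y * b' = 1"
    using \<open>d \<noteq> 0\<close> unfolding mult_cancel_left by simp
  define T where "T = mat 2 2 (\<lambda>(i, j). if i = 0 then (if j = 0 then b' else - a')
     else (if j = 0 then z * x else z * y))"
  have T: "T \<in> carrier_mat 2 2" by (simp add: T_def)
  define T' where "T' = mat 2 2 (\<lambda>(i, j). if i = 0 then (if j = 0 then z * y else a')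
     else (if j = 0 then - (z * x) else b'))"
  have "T * T' = 1\<^sub>m 2"
  proof (rule eq_matI)
    fix i j :: nat assume "i < dim_row (1\<^sub>m 2 :: 'a mat)" "j < dim_col (1\<^sub>m 2 :: 'a mat)"
    then have "i \<in> {0, 1}" "j \<in> {0, 1}" by auto
    then show "(T * T') $$ (i, j) = 1\<^sub>m 2 $$ (i, j)"
      using one by (auto simp: T_def T'_def scalar_prod_def numeral_2_eq_2 algebra_simps)
  qed (simp_all add: T_def T'_def)
  then have "unimodular_mat T"
    by (intro unimodular_matI[OF T, of T']) (simp_all add: T'_def)
  moreover have "T $$ (0, 0) * a + T $$ (0, 1) * b = 0"
    by (simp add: T_def ab algebra_simps)
  ultimately show ?thesis using that T by blast
qed

lemma vec_append_split:
  "v \<in> carrier_vec (n + k) \<Longrightarrow> v = vec n (\<lambda>i. v $ i) @\<^sub>v vec k (\<lambda>i. v $ (n + i))"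
  by (intro eq_vecI) auto

text \<open>
  Iterated Bezout elimination: the induction hypothesis gathers the gcd of the first entries in
  the last of these, and a unimodular \<open>2 \<times> 2\<close> block then merges it with the remaining entry.
\<close>
lemma unimodular_clear_vec:
  fixes v :: "'a::elementary_divisor_domain vec"
  assumes "v \<in> carrier_vec (Suc n)"
  shows "\<exists>V\<in>carrier_mat (Suc n) (Suc n). unimodular_mat V \<and> (\<forall>i<n. (V *\<^sub>v v) $ i = 0)"
  using assms
proof (induction n arbitrary: v)
  case 0
  show ?case by (intro bexI[of _ "1\<^sub>m 1"]) (auto simp: unimodular_mat_one)
next
  case (Suc n)
  define a where "a = vec (Suc n) (\<lambda>i. v $ i)"
  define b where "b = vec 1 (\<lambda>i. v $ (Suc n + i))"
  have v: "v = a @\<^sub>v b" unfolding a_def b_def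
    by (rule vec_append_split) (use Suc.prems in simp)
  have a: "a \<in> carrier_vec (Suc n)" and b: "b \<in> carrier_vec 1" by (auto simp: a_def b_def)
  obtain V where V: "V \<in> carrier_mat (Suc n) (Suc n)" "unimodular_mat V"
    and zero: "\<And>i. i < n \<Longrightarrow> (V *\<^sub>v a) $ i = 0"
    using Suc.IH[OF a] by auto
  define V1 where "V1 = four_block_mat V (0\<^sub>m (Suc n) 1) (0\<^sub>m 1 (Suc n)) (1\<^sub>m 1)"
  have V1: "V1 \<in> carrier_mat (Suc (Suc n)) (Suc (Suc n))" "unimodular_mat V1"
    using V four_block_carrier_mat[OF V(1) one_carrier_mat[of 1]]
      unimodular_mat_extend[OF V, of 1]
    by (auto simp: V1_def)
  have V1v: "V1 *\<^sub>v v = (V *\<^sub>v a) @\<^sub>v b"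
    unfolding V1_def v using mult_mat_vec_split[OF V(1) one_carrier_mat a b] b by simp
  define w where "w = V1 *\<^sub>v v"
  have w: "w \<in> carrier_vec (n + 2)" using V1 Suc.prems by (simp add: w_def)
  have w0: "w $ i = 0" if "i < n" for i
    using zero[OF that] that V a b by (simp add: w_def V1v)
  obtain T where T: "T \<in> carrier_mat 2 2" "unimodular_mat T"
    "T $$ (0, 0) * w $ n + T $$ (0, 1) * w $ Suc n = 0"
    using bezout_unimodular by blast
  define V2 where "V2 = four_block_mat (1\<^sub>m n) (0\<^sub>m n 2) (0\<^sub>m 2 n) T"
  have V2c: "V2 \<in> carrier_mat (n + 2) (n + 2)"
    unfolding V2_def by (rule four_block_carrier_mat[OF one_carrier_mat T(1)])
  have "det V2 = det T" unfolding V2_def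
    by (subst det_four_block_mat_lower_left_zero[of _ n _ 2]) (use T in auto)
  with V2c have V2: "V2 \<in> carrier_mat (Suc (Suc n)) (Suc (Suc n))" "unimodular_mat V2"
    using T V2c by (simp_all add: unimodular_mat_def)
  have wsplit: "w = vec n (\<lambda>i. w $ i) @\<^sub>v vec 2 (\<lambda>i. w $ (n + i))"
    by (rule vec_append_split[OF w])
  have "V2 *\<^sub>v w = 1\<^sub>m n *\<^sub>v vec n (\<lambda>i. w $ i) @\<^sub>v T *\<^sub>v vec 2 (\<lambda>i. w $ (n + i))"
    unfolding V2_def by (subst wsplit, rule mult_mat_vec_split) (use T in auto)
  also have "1\<^sub>m n *\<^sub>v vec n (\<lambda>i. w $ i) = vec n (\<lambda>i. w $ i)" by simp
  finally have V2w: "V2 *\<^sub>v w = vec n (\<lambda>i. w $ i) @\<^sub>v T *\<^sub>v vec 2 (\<lambda>i. w $ (n + i))" .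
  have "(V2 *\<^sub>v w) $ i = 0" if "i < Suc n" for i
  proof (cases "i < n")
    case True
    then show ?thesis using T w0 by (simp add: V2w)
  next
    case False
    then have "i = n" using that by simp
    then show ?thesis using T
      by (simp add: V2w scalar_prod_def numeral_2_eq_2)
  qed
  moreover have "V2 *\<^sub>v w = (V2 * V1) *\<^sub>v v"
    unfolding w_def using V1 V2 Suc.prems by simp
  ultimately show ?case
    using V1 V2 unimodular_mat_mult[OF V2(1) V1(1)]
    by (intro bexI[of _ "V2 * V1"]) auto
qed

text \<open>
  A nonzero kernel vector \<open>v\<close> is moved by a unimodular \<open>V\<close> to a multiple of the last unit vector.
  With \<open>W = V\<^bsup>-1\<^esup>\<close>, the last column of \<open>A W\<close> times the nonzero last entry of \<open>V v\<close> is \<open>A v = 0\<close>.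
\<close>
lemma singular_clear_column:
  fixes A :: "'a::elementary_divisor_domain mat"
  assumes A: "A \<in> carrier_mat (Suc n) (Suc n)" and "det A = 0"
  obtains W where "W \<in> carrier_mat (Suc n) (Suc n)" "unimodular_mat W"
    "\<And>i. i < Suc n \<Longrightarrow> (A * W) $$ (i, n) = 0"
proof -
  obtain v where v: "v \<in> carrier_vec (Suc n)" "v \<noteq> 0\<^sub>v (Suc n)" "A *\<^sub>v v = 0\<^sub>v (Suc n)"
    using assms det_0_iff_vec_prod_zero[OF A] by auto
  obtain V where V: "V \<in> carrier_mat (Suc n) (Suc n)" "unimodular_mat V"
    and zero: "\<And>i. i < n \<Longrightarrow> (V *\<^sub>v v) $ i = 0"
    using unimodular_clear_vec[OF v(1)] by auto
  obtain W where W: "W \<in> carrier_mat (Suc n) (Suc n)" "unimodular_mat W" "W * V = 1\<^sub>m (Suc n)"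
    using unimodular_mat_obtain_inverse[OF V] by blast
  define u where "u = V *\<^sub>v v"
  have u: "u \<in> carrier_vec (Suc n)" using V v by (simp add: u_def)
  have Wu: "W *\<^sub>v u = v"
    using assoc_mult_mat_vec[OF W(1) V(1) v(1)] W v by (simp add: u_def)
  have "u $ n \<noteq> 0"
  proof
    assume "u $ n = 0"
    then have "u = 0\<^sub>v (Suc n)"
      using u zero[folded u_def] by (intro eq_vecI) (auto simp: less_Suc_eq)
    moreover have "W *\<^sub>v 0\<^sub>v (Suc n) = 0\<^sub>v (Suc n)"
      using W(1) by (intro eq_vecI) auto
    ultimately show False using Wu v(2) by simp
  qed
  moreover have "(A * W) $$ (i, n) * u $ n = 0" if i: "i < Suc n" for i
  proof -
    have "(A * W *\<^sub>v u) $ i = (\<Sum>j<Suc n. (A * W) $$ (i, j) * u $ j)"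
      using mult_carrier_mat[OF A W(1)] u i
      by (simp add: scalar_prod_def atLeast0LessThan del: index_mult_mat sum.lessThan_Suc)
    also have "\<dots> = (A * W) $$ (i, n) * u $ n"
      using zero[folded u_def] by (simp del: index_mult_mat)
    finally have "(A * W) $$ (i, n) * u $ n = (A *\<^sub>v (W *\<^sub>v u)) $ i"
      using assoc_mult_mat_vec[OF A W(1) u] by simp
    then show ?thesis using Wu v i by simp
  qed
  ultimately show ?thesis using that W by auto
qed

text \<open>
  Clearing the last column of \<open>A\<close> and of its transpose. Column operations do not disturb a zero
  row, nor row operations a zero column, so both are clear at once.
\<close>
lemma singular_equivalent_zero_pad:
  fixes A :: "'a::elementary_divisor_domain mat"
  assumes A: "A \<in> carrier_mat (Suc n) (Suc n)" and "det A = 0"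
  obtains B where "B \<in> carrier_mat n n" "equivalent_mat A (zero_pad B 1)"
proof -
  obtain W where W: "W \<in> carrier_mat (Suc n) (Suc n)" "unimodular_mat W"
    and zc: "\<And>i. i < Suc n \<Longrightarrow> (A * W) $$ (i, n) = 0"
    using singular_clear_column[OF assms] by metis
  have At: "transpose_mat A \<in> carrier_mat (Suc n) (Suc n)" "det (transpose_mat A) = 0"
    using assms det_transpose[OF A] by auto
  obtain Y where Y: "Y \<in> carrier_mat (Suc n) (Suc n)" "unimodular_mat Y"
    and zr: "\<And>i. i < Suc n \<Longrightarrow> (transpose_mat A * Y) $$ (i, n) = 0"
    using singular_clear_column[OF At] by metis
  define U where "U = transpose_mat Y"
  have U: "U \<in> carrier_mat (Suc n) (Suc n)" "unimodular_mat U"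
    using Y unimodular_mat_transpose[OF Y] by (auto simp: U_def)
  have "transpose_mat (transpose_mat A * Y) = U * A"
    using transpose_mult[OF At(1) Y(1)] by (simp add: U_def)
  then have UA: "(U * A) $$ (n, i) = 0" if "i < Suc n" for i
    using zr[OF that] that index_transpose_mat(1)[of n "transpose_mat A * Y" i] A Y
    by (simp del: index_mult_mat(1))
  define N where "N = U * A * W"
  have N: "N \<in> carrier_mat (Suc n) (Suc n)" using U A W by (simp add: N_def)
  have row: "N $$ (n, j) = 0" if "j < Suc n" for j
    unfolding N_def index_mult_mat_sum[OF mult_carrier_mat[OF U(1) A] W(1) lessI that]
    by (intro sum.neutral) (simp add: UA)
  have "N = U * (A * W)"
    unfolding N_def by (rule assoc_mult_mat[OF U(1) A W(1)])
  then have col: "N $$ (i, n) = 0" if "i < Suc n" for i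
    using index_mult_mat_sum[OF U(1) mult_carrier_mat[OF A W(1)] that lessI] zc
    by (simp del: index_mult_mat(1))
  define B where "B = mat n n (\<lambda>ij. N $$ ij)"
  have "zero_pad B 1 = N"
  proof (rule eq_matI)
    fix i j assume "i < dim_row N" "j < dim_col N"
    then show "zero_pad B 1 $$ (i, j) = N $$ (i, j)"
      using N row col by (auto simp: zero_pad_def B_def less_Suc_eq)
  qed (use N in \<open>auto simp: zero_pad_def B_def\<close>)
  moreover have "equivalent_mat A N"
    using A U W unfolding equivalent_mat_def carrier_matD[OF A] carrier_matD[OF N]
    by (intro conjI bexI[of _ U] bexI[of _ W]) (simp_all add: N_def)
  ultimately show ?thesis using that[of B] by (simp add: B_def)
qed

lemma obtain_nonsingular_core:
  fixes A :: "'a::elementary_divisor_domain mat"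
  assumes "A \<in> carrier_mat n n"
  shows "\<exists>B k l. B \<in> carrier_mat k k \<and> det B \<noteq> 0 \<and> k + l = n \<and> equivalent_mat A (zero_pad B l)"
  using assms
proof (induction n arbitrary: A)
  case 0
  then have "det A = 1" by simp
  then show ?case using 0 equivalent_mat_refl
    by (intro exI[of _ A] exI[of _ 0]) auto
next
  case (Suc n)
  show ?case
  proof (cases "det A = 0")
    case False
    then show ?thesis using Suc.prems equivalent_mat_refl
      by (intro exI[of _ A] exI[of _ "Suc n"] exI[of _ 0]) auto
  next
    case True
    obtain A' where A': "A' \<in> carrier_mat n n" "equivalent_mat A (zero_pad A' 1)"
      using singular_equivalent_zero_pad[OF Suc.prems True] .
    obtain B k l where B: "B \<in> carrier_mat k k" "det B \<noteq> 0" "k + l = n"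
      "equivalent_mat A' (zero_pad B l)"
      using Suc.IH[OF A'(1)] by blast
    have "equivalent_mat A (zero_pad B (l + 1))"
      using equivalent_mat_trans[OF A'(2) equivalent_mat_zero_pad[OF B(4), of 1]]
      by (simp add: zero_pad_zero_pad)
    then show ?thesis using B
      by (intro exI[of _ B] exI[of _ k] exI[of _ "l + 1"]) auto
  qed
qed

section \<open>Cancelling zero blocks\<close>

text \<open>
  If a column of \<open>(B \<oplus> 0) W\<close> vanishes in its first \<open>l\<close> entries, the first \<open>l\<close> entries of that column
  of \<open>W\<close> form a vector in the kernel of the nonsingular \<open>B\<close>.
\<close>
lemma nonsingular_zero_pad_mult_zero:
  fixes B :: "'a::idom mat"
  assumes B: "B \<in> carrier_mat l l" "det B \<noteq> 0" and W: "W \<in> carrier_mat (l + q) n"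
    and j: "j < n" and zero: "\<And>i. i < l \<Longrightarrow> (zero_pad B q * W) $$ (i, j) = 0"
    and t: "t < l"
  shows "W $$ (t, j) = 0"
proof -
  define v where "v = vec l (\<lambda>i. W $$ (i, j))"
  have "B *\<^sub>v v = 0\<^sub>v l"
  proof (rule eq_vecI)
    fix i assume "i < dim_vec (0\<^sub>v l :: 'a vec)"
    then have i: "i < l" by simp
    have "(zero_pad B q * W) $$ (i, j) = (\<Sum>k<l + q. zero_pad B q $$ (i, k) * W $$ (k, j))"
      using index_mult_mat_sum[OF zero_pad_carrier[OF B(1)] W _ j] i by simp
    also have "\<dots> = (\<Sum>k<l. B $$ (i, k) * W $$ (k, j))"
      by (rule sum.mono_neutral_cong_right) (use i B in \<open>auto simp: zero_pad_def\<close>)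
    also have "\<dots> = (B *\<^sub>v v) $ i"
      using i B by (simp add: scalar_prod_def v_def atLeast0LessThan)
    finally show "(B *\<^sub>v v) $ i = 0\<^sub>v l $ i" using zero[OF i] i by simp
  qed (use B in simp)
  moreover have "v \<in> carrier_vec l" by (simp add: v_def)
  ultimately have "v = 0\<^sub>v l" using det_0_iff_vec_prod_zero[OF B(1)] B(2) by blast
  then show ?thesis using t by (metis index_vec index_zero_vec(1) v_def)
qed

lemma zero_row_imp_det_zero:
  fixes A :: "'a::idom mat"
  assumes A: "A \<in> carrier_mat n n" and i: "i < n" and zero: "\<And>j. j < n \<Longrightarrow> A $$ (i, j) = 0"
  shows "det A = 0"
proof -
  have "transpose_mat A *\<^sub>v unit_vec n i = 0\<^sub>v n"
    using A i zero by (intro eq_vecI) auto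
  moreover have "unit_vec n i \<noteq> (0\<^sub>v n :: 'a vec)"
    using i by (metis index_unit_vec(2) index_zero_vec(1) zero_neq_one)
  ultimately have "det (transpose_mat A) = 0"
    using A det_0_iff_vec_prod_zero[of "transpose_mat A" n] by (metis transpose_carrier_mat unit_vec_carrier)
  then show ?thesis using det_transpose[OF A] by simp
qed

text \<open>
  In \<open>U (A \<oplus> 0) = (B \<oplus> 0) W\<close> the columns of the left side from \<open>k\<close> on vanish, so \<open>W\<close> has a zero
  block with \<open>l\<close> rows in these columns. If \<open>k < l\<close>, then \<open>W\<close> is block triangular for the split at
  \<open>k\<close>, and its lower diagonal block begins with a zero row, so that \<open>det W = 0\<close>.
\<close>
lemma core_size_le:
  fixes A B :: "'a::idom mat"
  assumes A: "A \<in> carrier_mat k k" and B: "B \<in> carrier_mat l l" "det B \<noteq> 0"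
    and n: "k + p = l + q"
    and eq: "equivalent_mat (zero_pad A p) (zero_pad B q)"
  shows "l \<le> k"
proof (rule ccontr)
  assume "\<not> l \<le> k"
  then have kl: "k < l" by simp
  have Ap: "zero_pad A p \<in> carrier_mat (k + p) (k + p)" using A by simp
  have Bq: "zero_pad B q \<in> carrier_mat (k + p) (k + p)" using zero_pad_carrier[OF B(1), of q] n by simp
  obtain U W where U: "U \<in> carrier_mat (k + p) (k + p)" "unimodular_mat U"
    and W: "W \<in> carrier_mat (k + p) (k + p)" "unimodular_mat W"
    and UW: "U * zero_pad A p = zero_pad B q * W"
    using eq unfolding equivalent_mat_iff[OF Ap Bq] by (elim bexE conjE)
  have zero: "W $$ (t, j) = 0" if "t < l" "k \<le> j" "j < k + p" for t j
  proof (rule nonsingular_zero_pad_mult_zero[OF B])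
    fix i assume "i < l"
    then have i: "i < k + p" using n by simp
    have "(U * zero_pad A p) $$ (i, j) = (\<Sum>s<k + p. U $$ (i, s) * zero_pad A p $$ (s, j))"
      by (rule index_mult_mat_sum[OF U(1) Ap i \<open>j < k + p\<close>])
    also have "\<dots> = 0"
      by (intro sum.neutral) (use that A in \<open>auto simp: zero_pad_def\<close>)
    finally show "(zero_pad B q * W) $$ (i, j) = 0" using UW by simp
  qed (use W n that in auto)
  obtain W1 W2 W3 W4 where sp: "split_block W k k = (W1, W2, W3, W4)"
    by (cases "split_block W k k") auto
  have dW: "dim_row W = k + p" "dim_col W = k + p" using W by auto
  note spl = split_block[OF sp dW]
  have idx: "W $$ (i, k + j) = (if i < k then W2 $$ (i, j) else W4 $$ (i - k, j))"
    if "i < k + p" "j < p" for i j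
    using that spl(1-4) by (subst spl(5)) auto
  have W2: "W2 = 0\<^sub>m k p"
  proof (rule eq_matI)
    fix i j assume "i < dim_row (0\<^sub>m k p :: 'a mat)" "j < dim_col (0\<^sub>m k p :: 'a mat)"
    then show "W2 $$ (i, j) = 0\<^sub>m k p $$ (i, j)"
      using idx[of i j] zero[of i "k + j"] kl by simp
  qed (use spl in auto)
  have p: "0 < p" using kl n by simp
  have "det W4 = 0"
  proof (rule zero_row_imp_det_zero[OF spl(4) p])
    fix j assume "j < p"
    then show "W4 $$ (0, j) = 0" using idx[of k j] zero[of k "k + j"] kl p by simp
  qed
  then have "det W = 0"
    using det_four_block_mat_upper_right_zero[OF spl(1) W2 spl(3,4)] spl(5) by simp
  then show False using W(2) by (simp add: unimodular_mat_def)
qed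

text \<open>
  Comparing blocks in \<open>U (A \<oplus> 0) = (B \<oplus> 0) W\<close> gives \<open>U\<^sub>1 A = B W\<^sub>1\<close>, \<open>B W\<^sub>2 = 0\<close> and \<open>U\<^sub>3 A = 0\<close>.
  Nonsingularity yields \<open>W\<^sub>2 = 0\<close> and \<open>U\<^sub>3 = 0\<close>, so \<open>det U\<^sub>1\<close> divides \<open>det U\<close>, \<open>det W\<^sub>1\<close> divides
  \<open>det W\<close>, and both are units.
\<close>
lemma core_equivalent:
  fixes A B :: "'a::idom mat"
  assumes A: "A \<in> carrier_mat k k" "det A \<noteq> 0" and B: "B \<in> carrier_mat k k" "det B \<noteq> 0"
    and eq: "equivalent_mat (zero_pad A p) (zero_pad B p)"
  shows "equivalent_mat A B"
proof -
  have Ap: "zero_pad A p \<in> carrier_mat (k + p) (k + p)" using A by simp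
  have Bp: "zero_pad B p \<in> carrier_mat (k + p) (k + p)" using B by simp
  obtain U W where U: "U \<in> carrier_mat (k + p) (k + p)" "unimodular_mat U"
    and W: "W \<in> carrier_mat (k + p) (k + p)" "unimodular_mat W"
    and UW: "U * zero_pad A p = zero_pad B p * W"
    using eq unfolding equivalent_mat_iff[OF Ap Bp] by (elim bexE conjE)
  obtain W1 W2 W3 W4 where spW: "split_block W k k = (W1, W2, W3, W4)"
    by (cases "split_block W k k") auto
  have dW: "dim_row W = k + p" "dim_col W = k + p" using W by auto
  note splW = split_block[OF spW dW]
  obtain U1 U2 U3 U4 where spU: "split_block U k k = (U1, U2, U3, U4)"
    by (cases "split_block U k k") auto
  have dU: "dim_row U = k + p" "dim_col U = k + p" using U by auto
  note splU = split_block[OF spU dU]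
  have "U * zero_pad A p = four_block_mat (U1 * A) (0\<^sub>m k p) (U3 * A) (0\<^sub>m p p)"
    unfolding zero_pad_four_block[OF A(1)] using splU(1-4) A
    by (subst splU(5), subst mult_four_block_mat[OF splU(1-4), of _ k _ p]) auto
  moreover have "zero_pad B p * W = four_block_mat (B * W1) (B * W2) (0\<^sub>m p k) (0\<^sub>m p p)"
    unfolding zero_pad_four_block[OF B(1)] using splW(1-4) B
    by (subst splW(5), subst mult_four_block_mat[of _ k k _ p _ p _ _ k _ p]) auto
  ultimately have blocks: "four_block_mat (U1 * A) (0\<^sub>m k p) (U3 * A) (0\<^sub>m p p)
      = four_block_mat (B * W1) (B * W2) (0\<^sub>m p k) (0\<^sub>m p p)" (is "?L = ?R")
    using UW by simp
  have entry: "?L $$ (i, j) = ?R $$ (i, j)" for i j by (simp only: blocks)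
  have top: "U1 * A = B * W1"
  proof (rule eq_matI)
    fix i j assume "i < dim_row (B * W1)" "j < dim_col (B * W1)"
    then show "(U1 * A) $$ (i, j) = (B * W1) $$ (i, j)"
      using entry[of i j] splU(1-4) splW(1-4) A B by (simp del: index_mult_mat(1))
  qed (use splU splW A B in auto)
  have W2: "W2 = 0\<^sub>m k p"
  proof (rule eq_matI)
    fix i j assume ij: "i < dim_row (0\<^sub>m k p :: 'a mat)" "j < dim_col (0\<^sub>m k p :: 'a mat)"
    have "W2 $$ (i, j) = 0"
    proof (rule nonsingular_zero_pad_mult_zero[OF B, of _ 0])
      fix i assume "i < k"
      then show "(zero_pad B 0 * W2) $$ (i, j) = 0"
        using entry[of i "k + j"] ij splU(1-4) splW(1-4) A B by (simp del: index_mult_mat(1))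
    qed (use splW ij in auto)
    then show "W2 $$ (i, j) = 0\<^sub>m k p $$ (i, j)" using ij by simp
  qed (use splW in auto)
  \<comment> \<open>The equation \<open>U\<^sub>3 A = 0\<close> has its nonsingular factor on the right, hence the transposes.\<close>
  have At: "transpose_mat A \<in> carrier_mat k k" "det (transpose_mat A) \<noteq> 0"
    using A det_transpose[OF A(1)] by auto
  have U3: "U3 = 0\<^sub>m p k"
  proof (rule eq_matI)
    fix i j assume ij: "i < dim_row (0\<^sub>m p k :: 'a mat)" "j < dim_col (0\<^sub>m p k :: 'a mat)"
    have "transpose_mat U3 $$ (j, i) = 0"
    proof (rule nonsingular_zero_pad_mult_zero[OF At, of _ 0])
      fix s assume s: "s < k"
      have "(transpose_mat A * transpose_mat U3) $$ (s, i) = (U3 * A) $$ (i, s)"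
        using transpose_mult[OF splU(3) A(1)] s ij splU(3) A(1)
        by (metis carrier_matD index_mult_mat(2,3) index_transpose_mat(1) index_zero_mat(2))
      also have "\<dots> = 0"
        using entry[of "k + i" s] s ij splU(1-4) splW(1-4) A B by (simp del: index_mult_mat(1))
      finally show "(zero_pad (transpose_mat A) 0 * transpose_mat U3) $$ (s, i) = 0" by simp
    qed (use splU ij in auto)
    then show "U3 $$ (i, j) = 0\<^sub>m p k $$ (i, j)" using ij splU(3) by simp
  qed (use splU in auto)
  have "det W = det W1 * det W4"
    using det_four_block_mat_upper_right_zero[OF splW(1) W2 splW(3,4)] splW(5) by simp
  then have "unimodular_mat W1"
    using W(2) splW(1) by (auto simp: unimodular_mat_def dest: dvd_mult_left)
  moreover have "det U = det U1 * det U4"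
    using det_four_block_mat_lower_left_zero[OF splU(1,2) U3 splU(4)] splU(5) by simp
  then have "unimodular_mat U1"
    using U(2) splU(1) by (auto simp: unimodular_mat_def dest: dvd_mult_left)
  ultimately show ?thesis
    unfolding equivalent_mat_iff[OF A(1) B(1)] using top splU(1) splW(1) by blast
qed

text \<open>
  Padding does not change the nonsingular core, and the core together with the
  size determines a matrix up to equivalence.
\<close>
lemma zero_pad_cancel:
  fixes A B :: "'a::elementary_divisor_domain mat"
  assumes A: "A \<in> carrier_mat n n" and B: "B \<in> carrier_mat n n"
    and eq: "equivalent_mat (zero_pad A m) (zero_pad B m)"
  shows "equivalent_mat A B"
proof -
  obtain A1 k p where A1: "A1 \<in> carrier_mat k k" "det A1 \<noteq> 0" "k + p = n"
    "equivalent_mat A (zero_pad A1 p)"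
    using obtain_nonsingular_core[OF A] by blast
  obtain B1 l q where B1: "B1 \<in> carrier_mat l l" "det B1 \<noteq> 0" "l + q = n"
    "equivalent_mat B (zero_pad B1 q)"
    using obtain_nonsingular_core[OF B] by blast
  have "equivalent_mat (zero_pad A1 (p + m)) (zero_pad B1 (q + m))"
    using A1(4) B1(4) eq
    by (metis equivalent_mat_zero_pad equivalent_mat_sym equivalent_mat_trans zero_pad_zero_pad)
  note eq1 = this equivalent_mat_sym[OF this]
  have "l \<le> k" using core_size_le[OF A1(1) B1(1,2) _ eq1(1)] A1(3) B1(3) by simp
  moreover have "k \<le> l" using core_size_le[OF B1(1) A1(1,2) _ eq1(2)] A1(3) B1(3) by simp
  ultimately have kl: "l = k" "q = p" using A1(3) B1(3) by auto
  have "equivalent_mat A1 B1"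
    using core_equivalent[OF A1(1,2)] B1(1,2) eq1(1) unfolding kl by blast
  then show ?thesis
    using A1(4) B1(4) unfolding kl
    by (meson equivalent_mat_zero_pad equivalent_mat_sym equivalent_mat_trans)
qed

section \<open>Rows of matrices as polynomials\<close>

text \<open>
  Row \<open>i\<close> read as a polynomial with descending coefficients, which is the order of the
  coefficients in the first row of a companion matrix.
\<close>
definition row_poly :: "'a::comm_ring_1 mat \<Rightarrow> nat \<Rightarrow> 'a poly" where
  "row_poly A i = (\<Sum>j<dim_col A. monom (A $$ (i, j)) (dim_col A - 1 - j))"

lemma coeff_row_poly:
  assumes "A \<in> carrier_mat nr n" "j < n"
  shows "coeff (row_poly A i) (n - 1 - j) = A $$ (i, j)"
proof -
  have "coeff (row_poly A i) (n - 1 - j) = (\<Sum>k<n. if k = j then A $$ (i, k) else 0)"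
    unfolding row_poly_def coeff_sum using assms
    by (intro sum.cong) auto
  then show ?thesis using assms by simp
qed

lemma coeff_row_poly_ge:
  assumes "A \<in> carrier_mat nr n" "n \<le> k"
  shows "coeff (row_poly A i) k = 0"
  unfolding row_poly_def coeff_sum using assms by (intro sum.neutral) auto

lemma row_poly_eqI:
  assumes A: "A \<in> carrier_mat nr n" and deg: "degree p < n"
    and entries: "\<And>j. j < n \<Longrightarrow> A $$ (i, j) = coeff p (n - 1 - j)"
  shows "row_poly A i = p"
proof (rule poly_eqI)
  fix k
  show "coeff (row_poly A i) k = coeff p k"
  proof (cases "k < n")
    case True
    then have "k = n - 1 - (n - 1 - k)" "n - 1 - k < n" by auto
    then show ?thesis using coeff_row_poly[OF A, of "n - 1 - k" i] entries[of "n - 1 - k"] by simp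
  next
    case False
    then show ?thesis using coeff_row_poly_ge[OF A] deg by (simp add: coeff_eq_0)
  qed
qed

lemma monom_sum: "monom (sum c K) e = (\<Sum>k\<in>K. monom (c k) e)"
  by (induction K rule: infinite_finite_induct) (simp_all flip: add_monom)

lemma smult_sum_poly: "smult c (sum p K) = (\<Sum>k\<in>K. smult c (p k))"
  by (induction K rule: infinite_finite_induct) (simp_all add: smult_add_right)

lemma row_poly_mult:
  assumes A: "A \<in> carrier_mat nr n" and B: "B \<in> carrier_mat n nc" and i: "i < nr"
  shows "row_poly (A * B) i = (\<Sum>k<n. smult (A $$ (i, k)) (row_poly B k))"
proof -
  have "row_poly (A * B) i = (\<Sum>j<nc. \<Sum>k<n. monom (A $$ (i, k) * B $$ (k, j)) (nc - 1 - j))"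
    using B index_mult_mat_sum[OF A B i]
    by (simp add: row_poly_def monom_sum del: index_mult_mat(1))
  also have "\<dots> = (\<Sum>k<n. \<Sum>j<nc. monom (A $$ (i, k) * B $$ (k, j)) (nc - 1 - j))"
    by (rule sum.swap)
  also have "\<dots> = (\<Sum>k<n. smult (A $$ (i, k)) (row_poly B k))"
    using B by (simp add: row_poly_def smult_sum_poly smult_monom)
  finally show ?thesis .
qed

text \<open>
  Residues modulo a monic polynomial of degree \<open>n\<close> have a unique representative of degree below
  \<open>n\<close>, so an identity between matrices with \<open>n\<close> columns can be checked modulo \<open>g\<close>.
\<close>
lemma mat_eq_if_row_polys_cong:
  fixes g :: "'a::idom poly"
  assumes g: "lead_coeff g = 1" "degree g = n"
    and A: "A \<in> carrier_mat nr n" and B: "B \<in> carrier_mat nr n"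
    and cong: "\<And>i. i < nr \<Longrightarrow> g dvd row_poly A i - row_poly B i"
  shows "A = B"
proof (rule eq_matI)
  fix i j assume "i < dim_row B" "j < dim_col B"
  then have ij: "i < nr" "j < n" using B by auto
  have small: "coeff (row_poly A i - row_poly B i) k = 0" if "n \<le> k" for k
    using coeff_row_poly_ge[OF A that] coeff_row_poly_ge[OF B that] by simp
  have "row_poly A i - row_poly B i = 0"
  proof (rule ccontr)
    assume nz: "row_poly A i - row_poly B i \<noteq> 0"
    then have "n \<le> degree (row_poly A i - row_poly B i)"
      using dvd_imp_degree_le[OF cong[OF ij(1)]] g by simp
    then show False using small nz leading_coeff_0_iff by blast
  qed
  then show "A $$ (i, j) = B $$ (i, j)"
    using coeff_row_poly[OF A ij(2), of i] coeff_row_poly[OF B ij(2), of i] by simp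
qed (use A B in auto)

text \<open>
  If \<open>B\<close> is the matrix of multiplication by \<open>h\<close> modulo \<open>g\<close> in the monomial basis, then multiplying
  a matrix by \<open>B\<close> from the right multiplies its row polynomials by \<open>h\<close>.
\<close>
lemma row_poly_mult_cong:
  assumes A: "A \<in> carrier_mat nr n" and B: "B \<in> carrier_mat n n" and i: "i < nr"
    and cong: "\<And>k. k < n \<Longrightarrow> g dvd monom 1 (n - 1 - k) * h - row_poly B k"
  shows "g dvd row_poly A i * h - row_poly (A * B) i"
proof -
  have "row_poly A i * h = (\<Sum>k<n. smult (A $$ (i, k)) (monom 1 (n - 1 - k) * h))"
    using A by (simp add: row_poly_def sum_distrib_right smult_monom flip: mult_smult_left)
  then have "row_poly A i * h - row_poly (A * B) i
      = (\<Sum>k<n. smult (A $$ (i, k)) (monom 1 (n - 1 - k) * h - row_poly B k))"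
    by (simp add: row_poly_mult[OF A B i] smult_diff_right sum_subtractf)
  also have "g dvd \<dots>"
    by (intro dvd_sum dvd_smult cong) simp
  finally show ?thesis .
qed

lemma row_poly_one:
  assumes "i < n"
  shows "row_poly (1\<^sub>m n) i = monom 1 (n - 1 - i)"
  by (rule row_poly_eqI[OF one_carrier_mat]) (use assms in \<open>auto simp: degree_monom_eq\<close>)

lemma companion_mat_carrier[simp]: "companion_mat g \<in> carrier_mat (degree g) (degree g)"
  by (simp add: companion_mat_def)

text \<open>
  The companion matrix is multiplication by \<open>t\<close>: its subdiagonal shifts the monomials, and its
  first row is \<open>t\<^sup>n - g\<close>.
\<close>
lemma row_poly_companion_mat:
  assumes g: "lead_coeff g = 1" and i: "i < degree g"
  shows "g dvd monom 1 (degree g - 1 - i) * monom 1 1 - row_poly (companion_mat g) i"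
proof (cases i)
  case 0
  define n where "n = degree g"
  have "row_poly (companion_mat g) 0 = monom 1 n - g"
  proof (rule row_poly_eqI[OF companion_mat_carrier[of g], folded n_def])
    show "degree (monom 1 n - g) < n"
    proof (rule degree_lessI)
      show "\<forall>k\<ge>n. coeff (monom 1 n - g) k = 0"
        using g by (auto simp: n_def coeff_eq_0)
    qed (use i n_def in auto)
  qed (use i 0 in \<open>auto simp: n_def companion_mat_def\<close>)
  then show ?thesis using i 0 by (simp add: n_def mult_monom)
next
  case (Suc k)
  have "row_poly (companion_mat g) i = monom 1 (degree g - i)"
    by (rule row_poly_eqI[OF companion_mat_carrier])
      (use i Suc in \<open>auto simp: companion_mat_def degree_monom_eq\<close>)
  moreover have "degree g - 1 - i + 1 = degree g - i" using i Suc by simp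
  ultimately show ?thesis by (simp add: mult_monom del: One_nat_def)
qed

lemma row_poly_companion_mat_power:
  assumes g: "lead_coeff g = 1" and i: "i < degree g"
  shows "g dvd monom 1 (degree g - 1 - i) * monom 1 k - row_poly (companion_mat g ^\<^sub>m k) i"
proof (induction k)
  case 0
  show ?case using i by (simp add: companion_mat_def row_poly_one flip: one_poly_eq_simps(1) monom_0)
next
  case (Suc k)
  let ?C = "companion_mat g" and ?t = "monom 1 1"
  have "g dvd row_poly (?C ^\<^sub>m k) i * ?t - row_poly (?C ^\<^sub>m k * ?C) i"
    by (rule row_poly_mult_cong[OF pow_carrier_mat[OF companion_mat_carrier] companion_mat_carrier i])
      (rule row_poly_companion_mat[OF g])
  from dvd_add[OF dvd_mult2[OF Suc.IH, of ?t] this] show ?case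
    by (simp add: algebra_simps mult_monom)
qed

lemma poly_mat_carrier[simp]: "A \<in> carrier_mat n n \<Longrightarrow> poly_mat f A \<in> carrier_mat n n"
  by (auto simp: poly_mat_def)

lemma row_poly_poly_mat_companion:
  assumes g: "lead_coeff g = 1" and i: "i < degree g"
  shows "g dvd monom 1 (degree g - 1 - i) * f - row_poly (poly_mat f (companion_mat g)) i"
proof -
  let ?C = "companion_mat g" and ?n = "degree g"
  have C: "?C ^\<^sub>m k \<in> carrier_mat ?n ?n" for k by simp
  have "row_poly (poly_mat f ?C) i = (\<Sum>j<?n. monom (\<Sum>k\<le>degree f. coeff f k * (?C ^\<^sub>m k) $$ (i, j)) (?n - 1 - j))"
    unfolding row_poly_def using i C
    by (auto simp: poly_mat_def companion_mat_def intro!: sum.cong)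
  also have "\<dots> = (\<Sum>k\<le>degree f. \<Sum>j<?n. monom (coeff f k * (?C ^\<^sub>m k) $$ (i, j)) (?n - 1 - j))"
    by (simp add: monom_sum sum.swap[of _ "{..<?n}"])
  also have "\<dots> = (\<Sum>k\<le>degree f. smult (coeff f k) (row_poly (?C ^\<^sub>m k) i))"
    using carrier_matD(2)[OF C] by (simp add: row_poly_def smult_sum_poly smult_monom)
  finally have R: "row_poly (poly_mat f ?C) i = \<dots>" .
  have "monom 1 (?n - 1 - i) * f = monom 1 (?n - 1 - i) * (\<Sum>k\<le>degree f. monom (coeff f k) k)"
    by (simp add: poly_as_sum_of_monoms)
  also have "\<dots> = (\<Sum>k\<le>degree f. smult (coeff f k) (monom 1 (?n - 1 - i) * monom 1 k))"
    by (simp add: sum_distrib_left smult_monom mult_monom)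
  finally have "monom 1 (?n - 1 - i) * f - row_poly (poly_mat f ?C) i =
     (\<Sum>k\<le>degree f. smult (coeff f k) (monom 1 (?n - 1 - i) * monom 1 k - row_poly (?C ^\<^sub>m k) i))"
    by (simp add: R smult_diff_right sum_subtractf)
  also have "g dvd \<dots>"
    by (intro dvd_sum dvd_smult row_poly_companion_mat_power[OF g i])
  finally show ?thesis .
qed

section \<open>Bases adapted to a factorization\<close>

text \<open>
  For monic \<open>h\<close>, the polynomials \<open>h t\<^bsup>k-1\<^esup>, \<dots>, h\<close> followed by the monomials of degree below
  \<open>deg h\<close> form a basis of the polynomials of degree below \<open>deg h + k\<close>. They are listed by
  descending degree, so their coefficient matrix is upper unitriangular. The basis
  is needed with \<open>h = z\<close>, \<open>k = r\<close> and, up to order, with \<open>h = G\<close>, \<open>k = m\<close>.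
\<close>
definition factor_basis :: "'a::comm_ring_1 poly \<Rightarrow> nat \<Rightarrow> nat \<Rightarrow> 'a poly" where
  "factor_basis h k i = (if i < k then monom 1 (k - 1 - i) * h else monom 1 (degree h + k - 1 - i))"

definition factor_basis_mat :: "'a::comm_ring_1 poly \<Rightarrow> nat \<Rightarrow> 'a mat" where
  "factor_basis_mat h k = mat (degree h + k) (degree h + k)
     (\<lambda>(i, j). coeff (factor_basis h k i) (degree h + k - 1 - j))"

lemma degree_factor_basis:
  fixes h :: "'a::idom poly"
  assumes "lead_coeff h = 1" "i < degree h + k"
  shows "degree (factor_basis h k i) = degree h + k - 1 - i" "lead_coeff (factor_basis h k i) = 1"
proof -
  have "h \<noteq> 0" using assms by auto
  then show "degree (factor_basis h k i) = degree h + k - 1 - i"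
    using assms by (auto simp: factor_basis_def degree_monom_eq degree_mult_eq monom_eq_0_iff)
  show "lead_coeff (factor_basis h k i) = 1"
    using assms unfolding factor_basis_def by (simp add: lead_coeff_mult degree_monom_eq)
qed

lemma factor_basis_mat_carrier:
  "factor_basis_mat h k \<in> carrier_mat (degree h + k) (degree h + k)"
  by (simp add: factor_basis_mat_def)

lemma row_poly_factor_basis_mat:
  fixes h :: "'a::idom poly"
  assumes "lead_coeff h = 1" "i < degree h + k"
  shows "row_poly (factor_basis_mat h k) i = factor_basis h k i"
  by (rule row_poly_eqI[OF factor_basis_mat_carrier])
    (use assms in \<open>auto simp: degree_factor_basis factor_basis_mat_def\<close>)

lemma det_factor_basis_mat:
  fixes h :: "'a::idom poly"
  assumes h: "lead_coeff h = 1"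
  shows "det (factor_basis_mat h k) = 1"
proof -
  let ?n = "degree h + k"
  have "upper_triangular (factor_basis_mat h k)"
  proof (rule upper_triangularI)
    fix i j assume "j < i" "i < dim_row (factor_basis_mat h k)"
    then have "degree (factor_basis h k i) < ?n - 1 - j" "i < ?n" "j < ?n"
      by (auto simp: degree_factor_basis[OF h] factor_basis_mat_def)
    then show "factor_basis_mat h k $$ (i, j) = 0"
      by (simp add: factor_basis_mat_def coeff_eq_0)
  qed
  then have "det (factor_basis_mat h k) = (\<Prod>i = 0..<?n. factor_basis_mat h k $$ (i, i))"
    using det_upper_triangular[OF _ factor_basis_mat_carrier, of h k]
    by (simp add: prod_list_diag_prod factor_basis_mat_def)
  also have "\<dots> = 1"
    using degree_factor_basis[OF h] by (intro prod.neutral) (auto simp: factor_basis_mat_def)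
  finally show ?thesis .
qed

text \<open>
  The equation \<open>P f(C\<^sub>g) = (F(C\<^sub>G) \<oplus> 0) Q\<close> is checked on row polynomials modulo \<open>g = G z\<close>, with
  \<open>f = F z\<close>. Row \<open>i\<close> of the left side is \<open>p\<^sub>i f\<close>, where \<open>p\<^sub>i\<close> is the \<open>i\<close>-th polynomial of the source
  basis. For \<open>i < r\<close> the right side is \<open>z\<close> times a row of \<open>F(C\<^sub>G)\<close>, and a congruence
  modulo \<open>G\<close> becomes one modulo \<open>G z\<close> on multiplication by \<open>z\<close>. For \<open>i \<ge> r\<close> the
  right side is \<open>0\<close>, and \<open>p\<^sub>i f\<close> is a multiple of \<open>G z\<close>.
\<close>
lemma poly_mat_companion_factor:
  fixes F G z :: "'a::idom poly"
  assumes G: "lead_coeff G = 1" and z: "lead_coeff z = 1"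
  shows "equivalent_mat (poly_mat (F * z) (companion_mat (G * z)))
    (zero_pad (poly_mat F (companion_mat G)) (degree z))"
proof -
  define r m n where "r = degree G" and "m = degree z" and "n = r + m"
  have g: "lead_coeff (G * z) = 1" using G z by (simp add: lead_coeff_mult)
  have "G \<noteq> 0" "z \<noteq> 0" using G z by auto
  then have dg: "degree (G * z) = n" by (simp add: degree_mult_eq r_def m_def n_def)
  let ?M = "poly_mat (F * z) (companion_mat (G * z))"
  let ?N = "poly_mat F (companion_mat G)"
  have M: "?M \<in> carrier_mat n n" unfolding dg[symmetric] by simp
  have N: "?N \<in> carrier_mat r r" unfolding r_def by simp
  have pN: "zero_pad ?N m \<in> carrier_mat n n" using N by (simp add: n_def)
  define Q where "Q = factor_basis_mat z r"
  have Q: "Q \<in> carrier_mat n n"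
    using factor_basis_mat_carrier[of z r] by (simp add: Q_def n_def m_def add.commute)
  have uQ: "unimodular_mat Q"
    using det_factor_basis_mat[OF z, of r] Q by (simp add: Q_def unimodular_mat_def)
  define D where "D = factor_basis_mat G m"
  have D: "D \<in> carrier_mat n n"
    using factor_basis_mat_carrier[of G m] by (simp add: D_def n_def r_def)
  \<comment> \<open>The source basis has the monomials first, as \<open>F(C\<^sub>G)\<close> is to be the leading block, whereas the
    triangular matrix \<open>D\<close> has the multiples of \<open>G\<close> first.\<close>
  define rot where "rot i = (if i < r then m + i else if i < n then i - r else i)" for i
  have rot: "rot permutes {0..<n}"
  proof (rule bij_imp_permutes)
    show "bij_betw rot {0..<n} {0..<n}"
      by (rule bij_betw_byWitness[where f' = "\<lambda>i. if i < m then r + i else i - m"])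
        (auto simp: rot_def n_def)
  qed (auto simp: rot_def n_def)
  define P where "P = mat n n (\<lambda>(i, j). D $$ (rot i, j))"
  have P: "P \<in> carrier_mat n n" by (simp add: P_def)
  have "det P = signof rot * det D"
    unfolding P_def by (rule det_permute_rows[OF D rot])
  then have uP: "unimodular_mat P"
    using det_factor_basis_mat[OF G, of m] P by (simp add: D_def unimodular_mat_def sign_def)
  have row_P: "row_poly P i = factor_basis G m (rot i)" if "i < n" for i
  proof -
    have "rot i < n" using that by (auto simp: rot_def n_def)
    moreover have "row_poly P i = row_poly D (rot i)"
      using that D by (simp add: row_poly_def P_def)
    ultimately show ?thesis
      using row_poly_factor_basis_mat[OF G, of "rot i" m] by (simp add: D_def n_def r_def)
  qed
  have "P * ?M = zero_pad ?N m * Q"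
  proof (rule mat_eq_if_row_polys_cong[OF g dg])
    fix i assume i: "i < n"
    have L: "G * z dvd row_poly P i * (F * z) - row_poly (P * ?M) i"
      by (rule row_poly_mult_cong[OF P M i])
        (use row_poly_poly_mat_companion[OF g, unfolded dg] in blast)
    have "row_poly (zero_pad ?N m * Q) i = (\<Sum>k<n. smult (zero_pad ?N m $$ (i, k)) (row_poly Q k))"
      by (rule row_poly_mult[OF pN Q i])
    also have "\<dots> = (\<Sum>k<r. smult (zero_pad ?N m $$ (i, k)) (row_poly Q k))"
      by (rule sum.mono_neutral_right) (use N i in \<open>auto simp: zero_pad_def n_def\<close>)
    also have "\<dots> = (\<Sum>k<r. smult (zero_pad ?N m $$ (i, k)) (monom 1 (r - 1 - k) * z))"
      using row_poly_factor_basis_mat[OF z, of _ r]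
      by (intro sum.cong) (auto simp: Q_def factor_basis_def)
    finally have R: "row_poly (zero_pad ?N m * Q) i = \<dots>" .
    have "G * z dvd row_poly P i * (F * z) - row_poly (zero_pad ?N m * Q) i"
    proof (cases "i < r")
      case True
      have "row_poly (zero_pad ?N m * Q) i = row_poly ?N i * z"
        unfolding R using N True
        by (simp add: row_poly_def zero_pad_def sum_distrib_right smult_monom flip: mult_smult_left)
      moreover have "row_poly P i = monom 1 (r - 1 - i)"
        using row_P[OF i] True by (simp add: rot_def factor_basis_def r_def)
      moreover have "G dvd monom 1 (r - 1 - i) * F - row_poly ?N i"
        using row_poly_poly_mat_companion[OF G, of i F] True by (simp add: r_def)
      then have "G * z dvd (monom 1 (r - 1 - i) * F - row_poly ?N i) * z"
        by (rule mult_dvd_mono) simp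
      ultimately show ?thesis by (simp add: algebra_simps)
    next
      case False
      then have "row_poly (zero_pad ?N m * Q) i = 0"
        unfolding R using N i by (intro sum.neutral) (auto simp: zero_pad_def n_def)
      moreover have "row_poly P i = monom 1 (n - 1 - i) * G"
        using row_P[OF i] False i by (auto simp: rot_def factor_basis_def n_def add.commute)
      ultimately show ?thesis by (simp add: algebra_simps)
    qed
    from dvd_diff[OF this L]
    show "G * z dvd row_poly (P * ?M) i - row_poly (zero_pad ?N m * Q) i" by simp
  qed (use P M pN Q in auto)
  then show ?thesis
    unfolding m_def[symmetric] equivalent_mat_iff[OF M pN] using P Q uP uQ by blast
qed

section \<open>Invariant factors of a padded matrix\<close>

lemma smith_form_mat_zero_pad:
  assumes "S \<in> carrier_mat n n"
  shows "smith_form_mat (zero_pad S m) \<longleftrightarrow> smith_form_mat S"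
proof
  assume S: "smith_form_mat (zero_pad S m)"
  have "S $$ (i, j) = zero_pad S m $$ (i, j)" if "i < n" "j < n" for i j
    using that assms by (simp add: zero_pad_def)
  then show "smith_form_mat S"
    using S assms zero_pad_carrier[OF assms, of m] unfolding smith_form_mat_def diagonal_mat_def
    by auto
next
  assume "smith_form_mat S"
  then show "smith_form_mat (zero_pad S m)"
    using assms by (auto simp: smith_form_mat_def diagonal_mat_def zero_pad_def)
qed

lemma zero_pad_diagonal:
  assumes S: "S \<in> carrier_mat (n + m) (n + m)" "diagonal_mat S"
    and zero: "\<And>i. n \<le> i \<Longrightarrow> i < n + m \<Longrightarrow> S $$ (i, i) = 0"
  shows "S = zero_pad (mat n n (\<lambda>ij. S $$ ij)) m"
proof (rule eq_matI)
  fix i j assume "i < dim_row (zero_pad (mat n n (\<lambda>ij. S $$ ij)) m)"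
    "j < dim_col (zero_pad (mat n n (\<lambda>ij. S $$ ij)) m)"
  then have ij: "i < n + m" "j < n + m" by (simp_all add: zero_pad_def)
  show "S $$ (i, j) = zero_pad (mat n n (\<lambda>ij. S $$ ij)) m $$ (i, j)"
  proof (cases "i = j")
    case True
    then show ?thesis using ij zero[of i] by (auto simp: zero_pad_def)
  next
    case False
    then show ?thesis using ij S by (auto simp: zero_pad_def diagonal_mat_def)
  qed
qed (use S in \<open>auto simp: zero_pad_def\<close>)

text \<open>
  Padding a Smith form gives a Smith form because \<open>0\<close> is divisible by everything. For the converse,
  a diagonal matrix with \<open>m\<close> trailing zeros is itself padded, and \<open>zero_pad_cancel\<close> removes the
  padding on both sides.
\<close>
lemma has_invariant_factors_zero_pad:
  fixes A M :: "'a::elementary_divisor_domain mat"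
  assumes A: "A \<in> carrier_mat r r" and eq: "equivalent_mat M (zero_pad A m)"
    and ss: "length ss = r"
  shows "has_invariant_factors A ss \<longleftrightarrow> has_invariant_factors M (ss @ replicate m 0)"
proof
  assume "has_invariant_factors A ss"
  then obtain S where S: "smith_form_mat S" "equivalent_mat A S"
    "ss = map (\<lambda>i. S $$ (i, i)) [0..<min (dim_row S) (dim_col S)]"
    unfolding has_invariant_factors_def by blast
  have Sc: "S \<in> carrier_mat r r" using equivalent_mat_carrier[OF S(2)] A by simp
  have "ss @ replicate m 0 = map (\<lambda>i. zero_pad S m $$ (i, i)) [0..<r + m]"
    using Sc ss S(3) by (intro nth_equalityI) (auto simp: nth_append zero_pad_def)
  moreover have "smith_form_mat (zero_pad S m)"
    using S(1) smith_form_mat_zero_pad[OF Sc] by simp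
  moreover have "equivalent_mat M (zero_pad S m)"
    using equivalent_mat_trans[OF eq equivalent_mat_zero_pad[OF S(2)]] .
  ultimately show "has_invariant_factors M (ss @ replicate m 0)"
    using zero_pad_carrier[OF Sc, of m] unfolding has_invariant_factors_def
    by (intro exI[of _ "zero_pad S m"]) simp
next
  assume "has_invariant_factors M (ss @ replicate m 0)"
  then obtain S where S: "smith_form_mat S" "equivalent_mat M S"
    "ss @ replicate m 0 = map (\<lambda>i. S $$ (i, i)) [0..<min (dim_row S) (dim_col S)]"
    unfolding has_invariant_factors_def by blast
  have Sc: "S \<in> carrier_mat (r + m) (r + m)"
    using equivalent_mat_carrier[OF S(2)] equivalent_mat_carrier[OF eq] zero_pad_carrier[OF A] by blast
  have diag: "(ss @ replicate m 0) ! i = S $$ (i, i)" if "i < r + m" for i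
    using S(3) Sc that by simp
  define T where "T = mat r r (\<lambda>ij. S $$ ij)"
  have T: "T \<in> carrier_mat r r" by (simp add: T_def)
  have ST: "S = zero_pad T m"
    unfolding T_def
  proof (rule zero_pad_diagonal[OF Sc])
    show "diagonal_mat S" using S(1) by (simp add: smith_form_mat_def)
    show "S $$ (i, i) = 0" if "r \<le> i" "i < r + m" for i
      using diag[OF that(2)] that ss by (simp add: nth_append)
  qed
  have "equivalent_mat (zero_pad A m) (zero_pad T m)"
    using equivalent_mat_trans[OF equivalent_mat_sym[OF eq] S(2)] ST by simp
  then have "equivalent_mat A T" by (rule zero_pad_cancel[OF A T])
  moreover have "smith_form_mat T"
    using S(1) smith_form_mat_zero_pad[OF T] ST by simp
  moreover have "ss = map (\<lambda>i. T $$ (i, i)) [0..<r]"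
  proof (rule nth_equalityI)
    fix i assume "i < length ss"
    then show "ss ! i = map (\<lambda>i. T $$ (i, i)) [0..<r] ! i"
      using diag[of i] ss by (simp add: nth_append T_def)
  qed (use ss in simp)
  ultimately show "has_invariant_factors A ss"
    using T unfolding has_invariant_factors_def by (intro exI[of _ T]) simp
qed

theorem theorem1:
  fixes f g F G z :: "'a::elementary_divisor_domain poly" and n m r :: nat
  assumes "lead_coeff g = 1" and "degree g = n"
    and "lead_coeff z = 1" and "degree z = m"
    and "g = G * z" and "f = F * z"
    and "r = n - m"
  shows "equivalent_mat (poly_mat f (companion_mat g))
           (diag_block_mat [poly_mat F (companion_mat G), 0\<^sub>m m m]) \<and>
         (\<forall>ss. length ss = r \<longrightarrow>
           (has_invariant_factors (poly_mat F (companion_mat G)) ss \<longleftrightarrow>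
            has_invariant_factors (poly_mat f (companion_mat g)) (ss @ replicate m 0)))"
proof -
  have "z \<noteq> 0" "g \<noteq> 0" using assms by auto
  have G: "lead_coeff G = 1" using assms by (simp add: lead_coeff_mult)
  then have "degree g = degree G + m"
    using assms \<open>g \<noteq> 0\<close> by (simp add: degree_mult_eq)
  then have r: "r = degree G" using assms by simp
  have N: "poly_mat F (companion_mat G) \<in> carrier_mat r r" unfolding r by simp
  have eq: "equivalent_mat (poly_mat f (companion_mat g)) (zero_pad (poly_mat F (companion_mat G)) m)"
    using poly_mat_companion_factor[OF G assms(3), of F] assms(4-6) by simp
  show ?thesis
    unfolding diag_block_mat_zero using eq has_invariant_factors_zero_pad[OF N eq] by blast
qed

end
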